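(* Let $n_1,n_2$ be positive integers and $n=\min\{n_1,n_2\}$. Let $f\in\mathcal{A}_{n_1}$ and $g\in\mathcal{A}_{n_2}\cap\mathcal{S}^{*}$. Let $\beta\ge0$, $\gamma\ge0$ be real with $\beta+\gamma>0$, let $0<\mu\le1$ and $\delta>0$ be real, and let $\rho$ be a real number with $\rho>\sqrt{\dfrac{\delta}{\delta+\mu n}}$. Suppose that $$ \left|\left(\frac{g(z)}{zf'(z)}\right)^{\frac1\mu}-1\right|^{\beta}\left|\delta-1-\frac{zf''(z)}{f'(z)}+\frac{zg'(z)}{g(z)}\right|^{\gamma}<\rho^{\beta}\left(\delta+\frac{\mu\rho n}{1+\rho}\right)^{\gamma}\qquad\text{for all } z\in\mathbb{U}. $$ Then $$ \left|\left(\frac{g(z)}{zf'(z)}\right)^{\frac1\mu}-1\right|<\rho\qquad\text{for all } z\in\mathbb{U}. $$ If in addition $\rho<1$, then $f\in\mathcal{STC}(\mu)$.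
   Context: $\mathbb{U}=\{z\in\mathbb{C}:|z|<1\}$ is the open unit disk. For a positive integer $m$, $\mathcal{A}_m$ is the class of functions analytic in $\mathbb{U}$ of the form $f(z)=z+a_{m+1}z^{m+1}+a_{m+2}z^{m+2}+\cdots$; $\mathcal{A}=\mathcal{A}_1$ (which contains every $\mathcal{A}_m$). $\mathcal{S}^{*}$ is the class of functions $g\in\mathcal{A}$ with $\mathrm{Re}\left(\frac{zg'(z)}{g(z)}\right)>0$ for all $z\in\mathbb{U}$ (starlike functions). Quotients such as $zg'(z)/g(z)$, $zf'(z)/g(z)$ and $g(z)/(zf'(z))$ are given their limiting value $1$ at $z=0$; $g$ has no zero in $\mathbb{U}\setminus\{0\}$. For $0<\mu\le1$, $\mathcal{STC}(\mu)$ (strongly close-to-convex functions of order $\mu$) is the class of $f\in\mathcal{A}$ for which there exists $g\in\mathcal{S}^{*}$ with $\mathrm{Re}\left(\left(\frac{zf'(z)}{g(z)}\right)^{1/\mu}\right)>0$ for all $z\in\mathbb{U}$. Conventions: the expressions in the hypothesis are understood to be well defined, so $f'(z)\ne0$ in $\mathbb{U}$. The powers $(g(z)/(zf'(z)))^{1/\mu}$ and $(zf'(z)/g(z))^{1/\mu}$ are the analytic branches in $\mathbb{U}$ with value $1$ at $z=0$. Real powers of nonnegative reals have their usual meaning, with $x^0=1$ (including $x=0$). *)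

theory Defs
  imports "HOL-Complex_Analysis.Complex_Analysis"
begin

abbreviation unit_disk :: "complex set" ("\<U>")
  where "\<U> \<equiv> ball 0 1"

text \<open>Functions on the disk are total functions whose values outside the disk are irrelevant.\<close>

definition class_A :: "nat \<Rightarrow> (complex \<Rightarrow> complex) set" where
  "class_A m = {f. f holomorphic_on \<U> \<and>
     (\<exists>a. \<forall>z\<in>\<U>. (\<lambda>k. a k * z ^ (m + 1 + k)) sums (f z - z))}"

text \<open>The quotient \<open>p z / q z\<close> with the value 1 at the origin. It is used only for
  \<open>p z = z + \<dots>\<close> and \<open>q z = z + \<dots>\<close>, where 1 is the limit at the origin.\<close>

definition unit_quot :: "(complex \<Rightarrow> complex) \<Rightarrow> (complex \<Rightarrow> complex) \<Rightarrow> complex \<Rightarrow> complex" where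
  "unit_quot p q z = (if z = 0 then 1 else p z / q z)"

text \<open>Analytic branches on the disk. The choice of the logarithm is unique on the disk, and possible
  whenever \<open>h\<close> is holomorphic and zero-free there with \<open>h 0 = 1\<close>; see the two lemmas below.
  The principal value \<open>powr\<close> would be wrong, since \<open>h\<close> may cross the negative real axis.\<close>

definition disk_log :: "(complex \<Rightarrow> complex) \<Rightarrow> complex \<Rightarrow> complex" where
  "disk_log h = (SOME L. L holomorphic_on \<U> \<and> L 0 = 0 \<and> (\<forall>z\<in>\<U>. exp (L z) = h z))"

definition disk_power :: "(complex \<Rightarrow> complex) \<Rightarrow> real \<Rightarrow> complex \<Rightarrow> complex" where
  "disk_power h a z = exp (of_real a * disk_log h z)"

lemma disk_log:
  assumes "h holomorphic_on \<U>" "\<And>z. z \<in> \<U> \<Longrightarrow> h z \<noteq> 0" "h 0 = 1"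
  shows "disk_log h holomorphic_on \<U>" "disk_log h 0 = 0"
    and "\<And>z. z \<in> \<U> \<Longrightarrow> exp (disk_log h z) = h z"
proof -
  obtain l where l: "l holomorphic_on \<U>" "\<And>z. z \<in> \<U> \<Longrightarrow> h z = exp (l z)"
    using contractible_imp_holomorphic_log[OF assms(1) convex_imp_contractible[OF convex_ball]] assms(2)
    by metis
  have "exp (l 0) = 1" using l(2)[of 0] assms(3) by simp
  then have "(\<lambda>z. l z - l 0) holomorphic_on \<U> \<and> l 0 - l 0 = 0 \<and>
      (\<forall>z\<in>\<U>. exp (l z - l 0) = h z)"
    using l by (auto intro!: holomorphic_intros simp: exp_diff)
  then have "\<exists>L. L holomorphic_on \<U> \<and> L 0 = 0 \<and> (\<forall>z\<in>\<U>. exp (L z) = h z)"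
    by (rule exI[where x = "\<lambda>z. l z - l 0"])
  from someI_ex[OF this, folded disk_log_def]
  show "disk_log h holomorphic_on \<U>" "disk_log h 0 = 0"
    and "\<And>z. z \<in> \<U> \<Longrightarrow> exp (disk_log h z) = h z"
    by auto
qed

lemma disk_log_unique:
  assumes L: "L holomorphic_on \<U>" "L 0 = 0" "\<And>z. z \<in> \<U> \<Longrightarrow> exp (L z) = h z"
    and M: "M holomorphic_on \<U>" "M 0 = 0" "\<And>z. z \<in> \<U> \<Longrightarrow> exp (M z) = h z"
    and z: "z \<in> \<U>"
  shows "L z = M z"
proof -
  have "((\<lambda>w. L w - M w) has_field_derivative 0) (at w within \<U>)" if w: "w \<in> \<U>" for w
  proof -
    have dL: "(L has_field_derivative deriv L w) (at w)"
      using L(1) w by (intro holomorphic_derivI[of _ \<U>]) auto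
    have dM: "(M has_field_derivative deriv M w) (at w)"
      using M(1) w by (intro holomorphic_derivI[of _ \<U>]) auto
    have "((\<lambda>w. exp (L w)) has_field_derivative exp (L w) * deriv L w) (at w)"
      by (rule DERIV_fun_exp[OF dL])
    moreover have "((\<lambda>w. exp (L w)) has_field_derivative exp (M w) * deriv M w) (at w)"
      by (rule has_field_derivative_transform_within_open[OF DERIV_fun_exp[OF dM], of \<U>])
        (use w L(3) M(3) in auto)
    ultimately have "exp (L w) * deriv L w = exp (M w) * deriv M w"
      by (rule DERIV_unique)
    moreover have "exp (L w) = exp (M w)" using L(3) M(3) w by simp
    ultimately have "deriv L w = deriv M w" by simp
    then show ?thesis
      using DERIV_diff[OF dL dM] by (auto intro: has_field_derivative_at_within)
  qed
  then obtain c where "\<forall>w\<in>\<U>. L w - M w = c"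
    using has_field_derivative_zero_constant[of \<U> "\<lambda>w. L w - M w"] by auto
  with L(2) M(2) z show ?thesis
    by (metis centre_in_ball diff_self eq_iff_diff_eq_0 zero_less_one)
qed

definition starlike_class :: "(complex \<Rightarrow> complex) set" where
  "starlike_class = {g \<in> class_A 1. (\<forall>z\<in>\<U> - {0}. g z \<noteq> 0) \<and>
     (\<forall>z\<in>\<U>. Re (unit_quot (\<lambda>z. z * deriv g z) g z) > 0)}"

text \<open>The condition \<open>deriv f z \<noteq> 0\<close> says that the analytic branch of the power exists.\<close>

definition STC :: "real \<Rightarrow> (complex \<Rightarrow> complex) set" where
  "STC \<mu> = {f \<in> class_A 1. (\<forall>z\<in>\<U>. deriv f z \<noteq> 0) \<and>
     (\<exists>g\<in>starlike_class. \<forall>z\<in>\<U>.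
        Re (disk_power (unit_quot (\<lambda>z. z * deriv f z) g) (1 / \<mu>) z) > 0)}"

text \<open>Real powers of nonnegative reals with \<open>0\<^sup>0 = 1\<close>; in contrast, \<open>0 powr 0 = 0\<close>.\<close>

definition rpow :: "real \<Rightarrow> real \<Rightarrow> real" where
  "rpow x a = (if a = 0 then 1 else x powr a)"

end

theory Submission
  imports Defs
begin

text \<open>Put \<open>p = (g / (z f'))\<^sup>1\<^sup>/\<^sup>\<mu>\<close> and \<open>w = p - 1\<close>. Then \<open>w = O(z\<^sup>n)\<close>, and logarithmic differentiation turns the
  second factor of the hypothesis into \<open>\<bar>\<delta> + \<mu> z w' / (1 + w)\<bar>\<close>. If \<open>\<bar>w\<bar>\<close> reached \<open>\<rho>\<close>, then at a
  point of least modulus where it does, Jack's lemma gives \<open>z w' = k w\<close> with real \<open>k \<ge> n\<close>. The lower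
  bound on \<open>\<rho>\<close> is what makes \<open>\<bar>\<delta> + \<mu> k w / (1 + w)\<bar>\<close> minimal at \<open>w = \<rho>\<close> on the circle \<open>\<bar>w\<bar> = \<rho>\<close>,
  which contradicts the hypothesis. For \<open>\<rho> < 1\<close> the inequality \<open>\<bar>p - 1\<bar> < 1\<close> gives \<open>Re (1 / p) > 0\<close>.\<close>

section \<open>Orders of vanishing at the origin\<close>

text \<open>Dividing the tail of the series by \<open>z ^ (m + 1)\<close> leaves a power series that
  still converges on the whole disk, so the cofactor is holomorphic at 0 as well. Later arguments
  differentiate this cofactor instead of a series.\<close>

lemma class_A_factor:
  assumes "f \<in> class_A m"
  obtains F where "F holomorphic_on \<U>" "\<And>z. z \<in> \<U> \<Longrightarrow> f z = z + z ^ (m + 1) * F z"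
proof -
  obtain a where a: "\<And>z. z \<in> \<U> \<Longrightarrow> (\<lambda>k. a k * z ^ (m + 1 + k)) sums (f z - z)"
    using assms unfolding class_A_def by blast
  define F where "F z = (if z = 0 then a 0 else (f z - z) / z ^ (m + 1))" for z
  have sums: "(\<lambda>k. a k * (z - 0) ^ k) sums F z" if "z \<in> \<U>" for z
  proof (cases "z = 0")
    case True
    then show ?thesis using powser_sums_zero[of a] by (simp add: F_def)
  next
    case False
    from sums_divide[OF a[OF that], of "z ^ (m + 1)"] False show ?thesis
      by (simp add: F_def power_add)
  qed
  have "F holomorphic_on \<U>"
    by (rule power_series_holomorphic[OF sums])
  moreover have "f z = z + z ^ (m + 1) * F z" if "z \<in> \<U>" for z
    using sums_unique2[OF a[OF that]] that by (cases "z = 0") (auto simp: F_def)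
  ultimately show ?thesis using that by blast
qed

lemma class_A_mono:
  assumes "f \<in> class_A m" "l \<le> m"
  shows "f \<in> class_A l"
proof -
  obtain a where a: "\<And>z. z \<in> \<U> \<Longrightarrow> (\<lambda>k. a k * z ^ (m + 1 + k)) sums (f z - z)"
    using assms unfolding class_A_def by blast
  \<comment> \<open>The same series, preceded by \<open>m - l\<close> zero coefficients.\<close>
  define b where "b k = (if k < m - l then 0 else a (k - (m - l)))" for k
  have "(\<lambda>k. b k * z ^ (l + 1 + k)) sums (f z - z)" if "z \<in> \<U>" for z
  proof -
    have "(\<lambda>k. b (k + (m - l)) * z ^ (l + 1 + (k + (m - l)))) sums (f z - z)"
    proof -
      have "l + 1 + (k + (m - l)) = m + 1 + k" "b (k + (m - l)) = a k" for k
        using assms(2) by (simp_all add: b_def)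
      then show ?thesis using a[OF that] by (simp only:)
    qed
    then show ?thesis
      by (subst (asm) sums_zero_iff_shift) (auto simp: b_def)
  qed
  then show ?thesis using assms(1) unfolding class_A_def by blast
qed

text \<open>The mean value inequality on \<open>cball 0 (cmod z)\<close> turns the bound on
  \<open>deriv w\<close> into \<open>w = O(z ^ Suc m)\<close>. The quotient
  \<open>w z / z ^ Suc m\<close> is then bounded near 0, and its singularity is removable.\<close>

lemma holomorphic_factor_from_deriv:
  assumes w: "w holomorphic_on \<U>" "w 0 = 0"
    and K: "K holomorphic_on \<U>" "\<And>z. z \<in> \<U> \<Longrightarrow> deriv w z = z ^ m * K z"
  obtains h where "h holomorphic_on \<U>" "\<And>z. z \<in> \<U> \<Longrightarrow> w z = z ^ Suc m * h z"
proof -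
  have sub: "cball 0 (1/2) \<subseteq> \<U>" by auto
  obtain B where B: "\<And>z. z \<in> cball 0 (1/2) \<Longrightarrow> cmod (K z) \<le> B"
    using compact_imp_bounded[OF compact_continuous_image[OF
        holomorphic_on_imp_continuous_on[OF holomorphic_on_subset[OF K(1) sub]] compact_cball]]
    unfolding bounded_iff by blast
  have bound: "cmod (w z) \<le> B * cmod z ^ Suc m" if z: "z \<in> cball 0 (1/2)" for z
  proof -
    have "cmod (w z - w 0) \<le> (cmod z ^ m * B) * cmod (z - 0)"
    proof (rule field_differentiable_bound[of "cball 0 (cmod z)" w "deriv w"])
      fix u :: complex assume "u \<in> cball 0 (cmod z)"
      then have u: "u \<in> \<U>" "u \<in> cball 0 (1/2)" "cmod u \<le> cmod z" using z by auto
      show "(w has_field_derivative deriv w u) (at u within cball 0 (cmod z))"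
        using holomorphic_derivI[OF w(1) open_ball u(1)] by (rule has_field_derivative_at_within)
      show "cmod (deriv w u) \<le> cmod z ^ m * B"
        unfolding K(2)[OF u(1)] norm_mult norm_power
        using B[OF u(2)] u(3) by (intro mult_mono power_mono) auto
    qed auto
    then show ?thesis using w(2) by (simp add: mult_ac)
  qed
  have "(\<lambda>z. w z / z ^ Suc m) holomorphic_on \<U> - {0}"
    using w(1) by (intro holomorphic_intros) (auto intro: holomorphic_on_subset)
  moreover have "\<exists>B. \<forall>\<^sub>F z in at 0. cmod (w z / z ^ Suc m) \<le> B"
  proof (intro exI[of _ B])
    have "\<forall>\<^sub>F z in at 0. z \<in> ball 0 (1/2) \<and> z \<noteq> (0::complex)"
      by (intro eventually_conj eventually_neq_at_within eventually_at_in_open') auto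
    then show "\<forall>\<^sub>F z in at 0. cmod (w z / z ^ Suc m) \<le> B"
      by eventually_elim (use bound in \<open>auto simp: norm_divide norm_mult norm_power field_simps\<close>)
  qed
  ultimately obtain h where h: "h holomorphic_on \<U>" "\<And>z. z \<in> \<U> - {0} \<Longrightarrow> h z = w z / z ^ Suc m"
    using holomorphic_on_extend_bounded[of "\<lambda>z. w z / z ^ Suc m" \<U> 0] by auto
  have "w z = z ^ Suc m * h z" if "z \<in> \<U>" for z
    using h(2)[of z] that w(2) by (cases "z = 0") auto
  with h(1) show ?thesis using that by blast
qed

section \<open>Jack's lemma\<close>

text \<open>On the closed disk \<open>Re (cnj (h z0) * h z)\<close> is at most the square of
  \<open>cmod (h z0)\<close>, with equality at \<open>z0\<close>. Hence its derivative at
  \<open>z0\<close> along a curve that stays in the disk cannot be positive.\<close>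

lemma logarithmic_derivative_at_maximum:
  assumes h: "h holomorphic_on S" "open S" "cball 0 (cmod z0) \<subseteq> S"
    and max: "\<And>z. z \<in> cball 0 (cmod z0) \<Longrightarrow> cmod (h z) \<le> cmod (h z0)"
    and nz: "h z0 \<noteq> 0"
  obtains k where "k \<ge> 0" "z0 * deriv h z0 = of_real k * h z0"
proof -
  let ?D = "cnj (h z0) * (z0 * deriv h z0)"
  \<comment> \<open>Every direction that does not leave the closed disk gives a one-sided derivative test.\<close>
  have dir: "Re (\<zeta> * ?D) \<le> 0" if \<zeta>: "Re \<zeta> \<le> 0" for \<zeta>
  proof (rule ccontr)
    assume pos: "\<not> Re (\<zeta> * ?D) \<le> 0"
    have "z0 \<in> S" using h(3) by auto
    then have dh: "(h has_field_derivative deriv h z0) (at (z0 * exp (of_real 0 * \<zeta>)))"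
      using holomorphic_derivI[OF h(1,2)] by simp
    have "((\<lambda>t. z0 * exp (t * \<zeta>)) has_field_derivative z0 * \<zeta>) (at (of_real 0))"
      by (auto intro!: derivative_eq_intros)
    from DERIV_chain2[OF dh this]
    have "((\<lambda>t. cnj (h z0) * h (z0 * exp (t * \<zeta>))) has_field_derivative
        cnj (h z0) * (deriv h z0 * (z0 * \<zeta>))) (at (of_real 0))"
      by (rule DERIV_cmult)
    from has_field_derivative_Re[OF has_vector_derivative_real_field[OF this]]
    have "((\<lambda>t. Re (cnj (h z0) * h (z0 * exp (of_real t * \<zeta>)))) has_real_derivative
        Re (\<zeta> * ?D)) (at 0)"
      by (simp add: mult_ac)
    from DERIV_pos_inc_right[OF this] pos
    obtain d where "d > 0" "\<forall>t>0. t < d \<longrightarrow>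
        Re (cnj (h z0) * h (z0 * exp (of_real 0 * \<zeta>)))
        < Re (cnj (h z0) * h (z0 * exp (of_real (0 + t) * \<zeta>)))"
      unfolding not_le by blast
    then have d: "d > 0" "\<And>t. 0 < t \<Longrightarrow> t < d \<Longrightarrow>
        Re (cnj (h z0) * h z0) < Re (cnj (h z0) * h (z0 * exp (of_real t * \<zeta>)))"
      by (simp_all del: times_complex.sel)
    \<comment> \<open>Since \<open>Re \<zeta> \<le> 0\<close>, the curve
      \<open>z0 * exp (t * \<zeta>)\<close> stays in the closed disk for \<open>t \<ge> 0\<close>;
      any \<open>t\<close> strictly between 0 and \<open>d\<close> gives the contradiction.\<close>
    define z where "z = z0 * exp (of_real (d / 2) * \<zeta>)"
    have "Re (of_real (d / 2) * \<zeta>) \<le> 0" using d(1) \<zeta> by (simp add: mult_nonneg_nonpos)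
    then have "exp (Re (of_real (d / 2) * \<zeta>)) \<le> 1" by (simp only: exp_le_one_iff)
    then have "cmod z \<le> cmod z0"
      unfolding z_def norm_mult norm_exp_eq_Re by (rule mult_left_le) simp
    then have "cmod (h z) \<le> cmod (h z0)" using max by simp
    then have "Re (cnj (h z0) * h z) \<le> cmod (h z0) * cmod (h z0)"
      using complex_Re_le_cmod[of "cnj (h z0) * h z"]
      by (simp add: norm_mult) (meson mult_left_mono norm_ge_zero order_trans)
    moreover have "Re (cnj (h z0) * h z0) = cmod (h z0) * cmod (h z0)"
      by (simp add: power2_eq_square[symmetric] cmod_power2)
    moreover have "Re (cnj (h z0) * h z0) < Re (cnj (h z0) * h z)"
      using d(2)[of "d / 2"] d(1) by (simp add: z_def)
    ultimately show False by simp
  qed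
  \<comment> \<open>Both tangential directions are admissible, which makes \<open>?D\<close> real;
    the inward radial direction \<open>-1\<close> fixes its sign.\<close>
  have im: "Im ?D = 0" using dir[of \<i>] dir[of "- \<i>"] by simp
  have re: "Re ?D \<ge> 0" using dir[of "-1"] by simp
  have D: "?D = of_real (Re ?D)" using im by (simp add: complex_eq_iff)
  have c: "h z0 * cnj (h z0) = of_real ((cmod (h z0))\<^sup>2)"
    by (simp only: complex_norm_square)
  have "of_real ((cmod (h z0))\<^sup>2) * (z0 * deriv h z0) = h z0 * ?D"
    using c by (simp add: mult_ac)
  also have "\<dots> = of_real (Re ?D) * h z0" by (subst D) simp
  finally have "z0 * deriv h z0 = of_real (Re ?D / (cmod (h z0))\<^sup>2) * h z0"
    using nz by (simp add: field_simps)
  moreover have "Re ?D / (cmod (h z0))\<^sup>2 \<ge> 0"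
    using re by (rule divide_nonneg_nonneg) simp
  ultimately show ?thesis using that by blast
qed

text \<open>On the circle through \<open>z0\<close> the factor \<open>z ^ n\<close> has constant
  modulus, so \<open>cmod (h z)\<close> is also largest at \<open>z0\<close> there, and by the
  maximum principle on the whole closed disk. The logarithmic derivative of the product is then
  \<open>n\<close> plus the nonnegative contribution of \<open>h\<close>.\<close>

lemma jack_lemma:
  assumes h: "h holomorphic_on \<U>" and w: "\<And>z. z \<in> \<U> \<Longrightarrow> w z = z ^ n * h z"
    and z0: "z0 \<in> \<U>" "w z0 \<noteq> 0" "z0 \<noteq> 0"
    and max: "\<And>z. z \<in> cball 0 (cmod z0) \<Longrightarrow> cmod (w z) \<le> cmod (w z0)"
  obtains k where "k \<ge> real n" "z0 * deriv w z0 = of_real k * w z0"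
proof -
  have sub: "cball 0 (cmod z0) \<subseteq> \<U>" using z0 by auto
  have "cmod (h z) \<le> cmod (h z0)" if "z \<in> cball 0 (cmod z0)" for z
  proof (rule maximum_modulus_frontier[of h "cball 0 (cmod z0)"])
    fix u :: complex assume "u \<in> frontier (cball 0 (cmod z0))"
    then have u: "cmod u = cmod z0" using z0(3) by simp
    then show "cmod (h u) \<le> cmod (h z0)"
      using max[of u] z0 w[of u] w[of z0] by (simp add: norm_mult norm_power)
  next
    show "h holomorphic_on interior (cball 0 (cmod z0))"
      using h sub interior_subset holomorphic_on_subset by blast
    show "continuous_on (closure (cball 0 (cmod z0))) h"
      using holomorphic_on_imp_continuous_on[OF holomorphic_on_subset[OF h sub]] by simp
  qed (use that in auto)
  moreover have "h z0 \<noteq> 0" using w[OF z0(1)] z0(2) by auto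
  ultimately obtain k where k: "k \<ge> 0" "z0 * deriv h z0 = of_real k * h z0"
    using logarithmic_derivative_at_maximum[OF h open_ball sub] by blast
  have "((\<lambda>z. z ^ n * h z) has_field_derivative
      of_nat n * z0 ^ (n - 1) * h z0 + z0 ^ n * deriv h z0) (at z0)"
    using holomorphic_derivI[OF h open_ball z0(1)]
    by (auto intro!: derivative_eq_intros)
  then have "(w has_field_derivative of_nat n * z0 ^ (n - 1) * h z0 + z0 ^ n * deriv h z0) (at z0)"
    by (rule has_field_derivative_transform_within_open[OF _ open_ball z0(1)]) (simp add: w)
  then have "z0 * deriv w z0 = of_nat n * (z0 * z0 ^ (n - 1)) * h z0 + z0 ^ n * (z0 * deriv h z0)"
    by (simp add: DERIV_imp_deriv algebra_simps)
  also have "\<dots> = of_real (real n + k) * w z0"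
    using w[OF z0(1)] by (cases n) (simp_all add: k(2) algebra_simps)
  finally show ?thesis using that[of "real n + k"] k(1) by simp
qed

section \<open>Minimum of the second factor on the circle of radius \<open>\<rho>\<close>\<close>

text \<open>Squared, the difference of the two sides is affine in \<open>Re w\<close>; it vanishes at \<open>w = \<rho>\<close> and its
  slope has the sign of \<open>- (A - \<delta>) (A \<rho>\<^sup>2 - \<delta>)\<close>, where \<open>A = \<delta> + c\<close>.\<close>

lemma norm_affine_quotient_ge:
  fixes w :: complex
  assumes w: "cmod w = \<rho>" "1 + w \<noteq> 0" and c: "c \<ge> 0" "\<delta> > 0" and \<rho>: "\<rho> > 0" "\<rho>\<^sup>2 * (\<delta> + c) \<ge> \<delta>"
  shows "cmod (of_real \<delta> + of_real c * w / (1 + w)) \<ge> \<delta> + c * \<rho> / (1 + \<rho>)"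
proof -
  define A x where "A = \<delta> + c" and "x = Re w"
  have x: "x \<le> \<rho>" using complex_Re_le_cmod[of w] w(1) by (simp add: x_def)
  have sq: "(Re w)\<^sup>2 + (Im w)\<^sup>2 = \<rho>\<^sup>2" using w(1) by (simp flip: cmod_power2)
  have n1: "(cmod (1 + w))\<^sup>2 = 1 + \<rho>\<^sup>2 + 2 * x"
    unfolding cmod_power2 x_def sq[symmetric] by (simp add: power2_eq_square algebra_simps)
  have n2: "(cmod (of_real \<delta> + of_real A * w))\<^sup>2 = \<delta>\<^sup>2 + A\<^sup>2 * \<rho>\<^sup>2 + 2 * \<delta> * A * x"
    unfolding cmod_power2 x_def sq[symmetric] by (simp add: power2_eq_square algebra_simps)
  \<comment> \<open>The factor \<open>A * \<rho>\<^sup>2 - \<delta>\<close> is nonnegative by the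
    last assumption; this is where the lower bound on \<open>\<rho>\<close> enters.\<close>
  have "0 \<le> 2 * (\<rho> - x) * ((A - \<delta>) * (A * \<rho>\<^sup>2 - \<delta>))"
    using x c \<rho> by (intro mult_nonneg_nonneg) (auto simp: A_def algebra_simps)
  also have "\<dots> = (\<delta>\<^sup>2 + A\<^sup>2 * \<rho>\<^sup>2 + 2 * \<delta> * A * x) * (1 + \<rho>)\<^sup>2 - (\<delta> + A * \<rho>)\<^sup>2 * (1 + \<rho>\<^sup>2 + 2 * x)"
    by (simp add: power2_eq_square algebra_simps)
  finally have "((\<delta> + A * \<rho>) * cmod (1 + w))\<^sup>2 \<le> (cmod (of_real \<delta> + of_real A * w) * (1 + \<rho>))\<^sup>2"
    unfolding power_mult_distrib n1 n2 by simp
  then have "(\<delta> + A * \<rho>) * cmod (1 + w) \<le> cmod (of_real \<delta> + of_real A * w) * (1 + \<rho>)"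
    by (rule power2_le_imp_le) (use \<rho> in auto)
  moreover have "of_real \<delta> + of_real c * w / (1 + w) = (of_real \<delta> + of_real A * w) / (1 + w)"
    using w(2) by (simp add: A_def field_simps)
  moreover have "\<delta> + c * \<rho> / (1 + \<rho>) = (\<delta> + A * \<rho>) / (1 + \<rho>)"
    using \<rho>(1) by (simp add: A_def field_simps)
  ultimately show ?thesis
    using w(2) \<rho>(1) by (simp add: norm_divide field_simps)
qed

lemma rpow_mono: "0 \<le> a \<Longrightarrow> 0 \<le> x \<Longrightarrow> x \<le> y \<Longrightarrow> rpow x a \<le> rpow y a"
  by (auto simp: rpow_def intro: powr_mono2)

lemma rpow_nonneg: "rpow x a \<ge> 0"
  by (simp add: rpow_def)

text \<open>The points of the closed disk through \<open>z1\<close> with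
  \<open>cmod (w z) \<ge> \<rho>\<close> form a compact set; take one of least modulus. Strictly
  inside its circle the bound holds, so by continuity it holds weakly on the circle, which forces
  equality at \<open>z0\<close>.\<close>

lemma ex_first_norm_exceedance:
  fixes w :: "complex \<Rightarrow> complex"
  assumes w: "continuous_on \<U> w" "cmod (w 0) < \<rho>"
    and z1: "z1 \<in> \<U>" "cmod (w z1) \<ge> \<rho>"
  obtains z0 where "z0 \<in> \<U>" "z0 \<noteq> 0" "cmod (w z0) = \<rho>"
    "\<And>z. z \<in> cball 0 (cmod z0) \<Longrightarrow> cmod (w z) \<le> \<rho>"
proof -
  have sub: "cball 0 (cmod z1) \<subseteq> \<U>" using z1 by auto
  define T where "T = cball 0 (cmod z1) \<inter> (\<lambda>z. cmod (w z)) -` {\<rho>..}"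
  have "continuous_on (cball 0 (cmod z1)) (\<lambda>z. cmod (w z))"
    using w(1) sub by (auto intro!: continuous_intros intro: continuous_on_subset)
  then have "closed T"
    unfolding T_def by (intro continuous_closed_preimage) auto
  then have "compact T"
    using compact_Int_closed[OF compact_cball, of T 0 "cmod z1"] by (simp add: T_def Int_absorb1)
  moreover have "z1 \<in> T" using z1 by (simp add: T_def)
  ultimately obtain z0 where z0: "z0 \<in> T" "\<And>z. z \<in> T \<Longrightarrow> cmod z0 \<le> cmod z"
    using continuous_attains_inf[of T cmod] by (auto intro: continuous_intros)
  have z0U: "z0 \<in> \<U>" "cmod (w z0) \<ge> \<rho>" using z0(1) sub by (auto simp: T_def)
  have nz: "z0 \<noteq> 0" using z0U w(2) by auto
  have less: "cmod (w z) < \<rho>" if "z \<in> ball 0 (cmod z0)" for z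
  proof (rule ccontr)
    assume "\<not> cmod (w z) < \<rho>"
    then have "z \<in> T" using that z0(1) by (auto simp: T_def)
    then show False using z0(2) that by fastforce
  qed
  have le: "cmod (w z) \<le> \<rho>" if "z \<in> cball 0 (cmod z0)" for z
  proof -
    have "cball 0 (cmod z0) \<subseteq> \<U>" using z0U by auto
    then have "continuous_on (closure (ball 0 (cmod z0))) (\<lambda>z. cmod (w z))"
      using w(1) nz by (auto intro!: continuous_intros intro: continuous_on_subset)
    then show ?thesis
      by (rule continuous_le_on_closure) (use that nz less in \<open>auto intro: less_imp_le\<close>)
  qed
  show ?thesis
    using that[OF z0U(1) nz _ le] le[of z0] z0U(2) by simp
qed

theorem theorem5:
  fixes n1 n2 n :: nat and f g :: "complex \<Rightarrow> complex" and \<beta> \<gamma> \<mu> \<delta> \<rho> :: real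
  assumes "n1 > 0" and "n2 > 0" and "n = min n1 n2"
    and "f \<in> class_A n1" and "g \<in> class_A n2 \<inter> starlike_class"
    and "\<forall>z\<in>\<U>. deriv f z \<noteq> 0"
    and "\<beta> \<ge> 0" and "\<gamma> \<ge> 0" and "\<beta> + \<gamma> > 0"
    and "0 < \<mu>" and "\<mu> \<le> 1" and "\<delta> > 0"
    and "\<rho> > sqrt (\<delta> / (\<delta> + \<mu> * real n))"
    and "\<forall>z\<in>\<U>.
      rpow (cmod (disk_power (unit_quot g (\<lambda>z. z * deriv f z)) (1 / \<mu>) z - 1)) \<beta> *
      rpow (cmod (of_real \<delta> - 1 - z * deriv (deriv f) z / deriv f z
                  + unit_quot (\<lambda>z. z * deriv g z) g z)) \<gamma>
      < rpow \<rho> \<beta> * rpow (\<delta> + \<mu> * \<rho> * real n / (1 + \<rho>)) \<gamma>"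
  shows "(\<forall>z\<in>\<U>. cmod (disk_power (unit_quot g (\<lambda>z. z * deriv f z)) (1 / \<mu>) z - 1) < \<rho>)
    \<and> (\<rho> < 1 \<longrightarrow> f \<in> STC \<mu>)"
proof -

  \<comment> \<open>Factorizations of \<open>f\<close>, \<open>g\<close> and their quotient\<close>
  have n: "n > 0" "n \<le> n1" "n \<le> n2" using assms(1-3) by auto
  obtain F where F: "F holomorphic_on \<U>" "\<And>z. z \<in> \<U> \<Longrightarrow> f z = z + z ^ (n + 1) * F z"
    using class_A_factor[OF class_A_mono[OF assms(4) n(2)]] by blast
  obtain G where G: "G holomorphic_on \<U>" "\<And>z. z \<in> \<U> \<Longrightarrow> g z = z + z ^ (n + 1) * G z"
    using class_A_factor[OF class_A_mono[OF _ n(3)]] assms(5) by blast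
  have f: "f holomorphic_on \<U>" and g: "g holomorphic_on \<U>"
    using assms(4,5) by (auto simp: class_A_def)
  have f'nz: "deriv f z \<noteq> 0" if "z \<in> \<U>" for z using assms(6) that by blast
  have gnz: "g z \<noteq> 0" if "z \<in> \<U>" "z \<noteq> 0" for z
    using assms(5) that by (auto simp: starlike_class_def)
  define F1 where "F1 z = of_nat (n + 1) * F z + z * deriv F z" for z
  have F1: "F1 holomorphic_on \<U>"
    unfolding F1_def using F(1) by (auto intro!: holomorphic_intros)
  have f': "deriv f z = 1 + z ^ n * F1 z" if "z \<in> \<U>" for z
  proof -
    have "((\<lambda>z. z + z ^ (n + 1) * F z) has_field_derivative (1 + z ^ n * F1 z)) (at z)"
      using holomorphic_derivI[OF F(1) open_ball that] n(1) power_eq_if[of z n] unfolding F1_def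
      by (auto intro!: derivative_eq_intros simp: algebra_simps)
    then have "(f has_field_derivative (1 + z ^ n * F1 z)) (at z)"
      by (rule has_field_derivative_transform_within_open[OF _ open_ball that]) (simp add: F)
    then show ?thesis by (rule DERIV_imp_deriv)
  qed
  define q where "q = unit_quot g (\<lambda>z. z * deriv f z)"
  \<comment> \<open>From \<open>g z / z = 1 + z ^ n * G z\<close> and
    \<open>deriv f z = 1 + z ^ n * F1 z\<close>. This form has no singularity at 0 and so makes
    \<open>q\<close> holomorphic there.\<close>
  define H where "H z = (G z - F1 z) / deriv f z" for z
  have H: "H holomorphic_on \<U>"
    unfolding H_def using G(1) F1 f f'nz by (auto intro!: holomorphic_intros)
  have qH: "q z = 1 + z ^ n * H z" if "z \<in> \<U>" for z
  proof (cases "z = 0")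
    case False
    then have "q z = (1 + z ^ n * G z) / deriv f z"
      using G(2)[OF that] f'nz[OF that] by (simp add: q_def unit_quot_def field_simps)
    also have "\<dots> = 1 + z ^ n * H z"
      using f'[OF that] f'nz[OF that] by (simp add: H_def field_simps)
    finally show ?thesis .
  qed (use n in \<open>simp add: q_def unit_quot_def\<close>)
  have "(\<lambda>z. 1 + z ^ n * H z) holomorphic_on \<U>"
    using H by (auto intro!: holomorphic_intros)
  then have q: "q holomorphic_on \<U>"
    by (rule holomorphic_transform) (simp add: qH)
  have qnz: "q z \<noteq> 0" if "z \<in> \<U>" for z
    using gnz[OF that] f'nz[OF that] by (simp add: q_def unit_quot_def)
  have q0: "q 0 = 1" by (simp add: q_def unit_quot_def)

  \<comment> \<open>The branch \<open>p\<close> and the order of vanishing of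
    \<open>w = p - 1\<close>\<close>
  define L where "L = disk_log q"
  have L: "L holomorphic_on \<U>" "L 0 = 0" "\<And>z. z \<in> \<U> \<Longrightarrow> exp (L z) = q z"
    using disk_log[OF q qnz q0] by (auto simp: L_def)
  have dL: "deriv L z = deriv q z / q z" if "z \<in> \<U>" for z
  proof -
    have "((\<lambda>z. exp (L z)) has_field_derivative exp (L z) * deriv L z) (at z)"
      by (rule DERIV_fun_exp[OF holomorphic_derivI[OF L(1) open_ball that]])
    then have "(q has_field_derivative exp (L z) * deriv L z) (at z)"
      by (rule has_field_derivative_transform_within_open[OF _ open_ball that]) (simp add: L)
    then show ?thesis using L(3)[OF that] qnz[OF that] by (simp add: DERIV_imp_deriv)
  qed
  define p where "p = disk_power q (1 / \<mu>)"
  have p_def': "p z = exp (of_real (1 / \<mu>) * L z)" for z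
    by (simp add: p_def disk_power_def L_def)
  define w where "w z = p z - 1" for z
  have w: "w holomorphic_on \<U>" "w 0 = 0"
    using L unfolding w_def p_def' by (auto intro!: holomorphic_intros)
  have dw: "deriv w z = of_real (1 / \<mu>) * (p z * (deriv q z / q z))" if "z \<in> \<U>" for z
  proof -
    have "(w has_field_derivative of_real (1 / \<mu>) * (p z * deriv L z)) (at z)"
      unfolding w_def p_def' using holomorphic_derivI[OF L(1) open_ball that] assms(10)
      by (auto intro!: derivative_eq_intros)
    then show ?thesis by (simp add: DERIV_imp_deriv dL[OF that])
  qed
  \<comment> \<open>What is left of \<open>deriv w\<close> once \<open>z ^ (n - 1)\<close> is taken
    out of the derivative of \<open>1 + z ^ n * H z\<close>.\<close>
  define K where "K z = of_real (1 / \<mu>) * (p z * ((of_nat n * H z + z * deriv H z) / q z))" for z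
  have K: "K holomorphic_on \<U>"
    unfolding K_def p_def' using L H q qnz by (auto intro!: holomorphic_intros)
  have dwK: "deriv w z = z ^ (n - 1) * K z" if "z \<in> \<U>" for z
  proof -
    have "((\<lambda>z. 1 + z ^ n * H z) has_field_derivative
        z ^ (n - 1) * (of_nat n * H z + z * deriv H z)) (at z)"
      using holomorphic_derivI[OF H open_ball that] n(1) power_eq_if[of z n]
      by (auto intro!: derivative_eq_intros simp: algebra_simps)
    then have "(q has_field_derivative z ^ (n - 1) * (of_nat n * H z + z * deriv H z)) (at z)"
      by (rule has_field_derivative_transform_within_open[OF _ open_ball that]) (simp add: qH)
    then show ?thesis by (simp add: dw[OF that] K_def DERIV_imp_deriv)
  qed
  obtain h where h: "h holomorphic_on \<U>" "\<And>z. z \<in> \<U> \<Longrightarrow> w z = z ^ n * h z"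
    using holomorphic_factor_from_deriv[OF w K dwK] n(1) by auto

  \<comment> \<open>The logarithmic derivative of \<open>p\<close>\<close>
  have logderiv: "of_real \<mu> * (z * deriv w z) / p z
      = unit_quot (\<lambda>z. z * deriv g z) g z - 1 - z * deriv (deriv f) z / deriv f z"
    if z: "z \<in> \<U>" "z \<noteq> 0" for z
  proof -
    have df: "(deriv f has_field_derivative deriv (deriv f) z) (at z)"
      using f z(1) by (intro holomorphic_derivI[of _ \<U>] holomorphic_deriv) auto
    have dg: "(g has_field_derivative deriv g z) (at z)"
      by (rule holomorphic_derivI[OF g open_ball z(1)])
    have "((\<lambda>u. g u / (u * deriv f u)) has_field_derivative
        (deriv g z * (z * deriv f z) - g z * (deriv f z + z * deriv (deriv f) z))
        / (z * deriv f z)\<^sup>2) (at z)"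
      using df dg z f'nz[OF z(1)]
      by (auto intro!: derivative_eq_intros simp: power2_eq_square algebra_simps)
    then have "(q has_field_derivative
        (deriv g z * (z * deriv f z) - g z * (deriv f z + z * deriv (deriv f) z))
        / (z * deriv f z)\<^sup>2) (at z)"
      \<comment> \<open>\<open>q\<close> agrees with the plain quotient only away from 0, hence the
        punctured disk.\<close>
      by (rule has_field_derivative_transform_within_open[of _ _ _ "\<U> - {0}"])
        (use z in \<open>auto simp: q_def unit_quot_def\<close>)
    then have dq: "deriv q z = (deriv g z * (z * deriv f z) - g z * (deriv f z + z * deriv (deriv f) z))
        / (z * deriv f z)\<^sup>2"
      by (rule DERIV_imp_deriv)
    have qz: "q z = g z / (z * deriv f z)" using z by (simp add: q_def unit_quot_def)
    have "z * deriv q z / q z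
        = unit_quot (\<lambda>z. z * deriv g z) g z - 1 - z * deriv (deriv f) z / deriv f z"
      unfolding dq qz using z gnz[OF z] f'nz[OF z(1)]
      by (simp add: unit_quot_def field_simps power2_eq_square)
    moreover have "p z \<noteq> 0" by (simp add: p_def')
    then have "of_real \<mu> * (z * deriv w z) / p z = z * deriv q z / q z"
      using assms(10) by (simp add: dw[OF z(1)] field_simps)
    ultimately show ?thesis by simp
  qed

  \<comment> \<open>The bound on \<open>w\<close>\<close>
  have pos: "\<delta> / (\<delta> + \<mu> * real n) > 0" using assms(10,12) by (simp add: add_pos_nonneg)
  then have \<rho>: "\<rho> > 0" using assms(13) real_sqrt_gt_zero[OF pos] by linarith
  have "\<delta> / (\<delta> + \<mu> * real n) \<le> \<rho>\<^sup>2"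
    using sqrt_le_D assms(13) by auto
  then have \<rho>2: "\<delta> \<le> \<rho>\<^sup>2 * (\<delta> + \<mu> * real n)"
    using assms(10,12) by (simp add: field_simps add_pos_nonneg)
  have main: "cmod (w z1) < \<rho>" if z1: "z1 \<in> \<U>" for z1
  proof (rule ccontr)
    assume "\<not> cmod (w z1) < \<rho>"
    then obtain z0 where z0: "z0 \<in> \<U>" "z0 \<noteq> 0" "cmod (w z0) = \<rho>"
      "\<And>z. z \<in> cball 0 (cmod z0) \<Longrightarrow> cmod (w z) \<le> \<rho>"
      using ex_first_norm_exceedance[OF holomorphic_on_imp_continuous_on[OF w(1)], of \<rho> z1] w(2) \<rho> z1
      by auto
    obtain k where k: "k \<ge> real n" "z0 * deriv w z0 = of_real k * w z0"
      by (rule jack_lemma[OF h(1) h(2) z0(1)]) (use z0 \<rho> in auto)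
    \<comment> \<open>Jack's lemma gives only some \<open>k \<ge> n\<close>. Both the condition on
      \<open>\<rho>\<close> and the resulting lower bound improve as \<open>k\<close> grows, so
      \<open>n\<close> may be replaced by \<open>k\<close>.\<close>
    have \<mu>k: "\<mu> * real n \<le> \<mu> * k" using k(1) assms(10) by simp
    then have \<rho>2': "\<delta> \<le> \<rho>\<^sup>2 * (\<delta> + \<mu> * k)"
      using \<rho>2 by (meson add_left_mono mult_left_mono order_trans zero_le_power2)
    \<comment> \<open>\<open>p z0\<close> is a value of the exponential, hence nonzero.\<close>
    have pw: "p z0 = 1 + w z0" "1 + w z0 \<noteq> 0"
      by (simp_all add: w_def p_def')
    have "\<delta> + \<mu> * \<rho> * real n / (1 + \<rho>) \<le> \<delta> + (\<mu> * k) * \<rho> / (1 + \<rho>)"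
      using mult_right_mono[OF \<mu>k, of \<rho>] \<rho>
      by (intro add_left_mono divide_right_mono) (simp_all add: mult_ac)
    also have "\<dots> \<le> cmod (of_real \<delta> + of_real (\<mu> * k) * w z0 / (1 + w z0))"
      using norm_affine_quotient_ge[OF z0(3) pw(2) _ assms(12) \<rho> \<rho>2'] k(1) assms(10) by simp
    also have "of_real (\<mu> * k) * w z0 / (1 + w z0) = of_real \<mu> * (z0 * deriv w z0) / p z0"
      by (simp add: k(2) pw(1))
    also have "of_real \<delta> + \<dots> = of_real \<delta> - 1 - z0 * deriv (deriv f) z0 / deriv f z0
        + unit_quot (\<lambda>z. z * deriv g z) g z0"
      unfolding logderiv[OF z0(1,2)] by simp
    finally have "rpow (\<delta> + \<mu> * \<rho> * real n / (1 + \<rho>)) \<gamma>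
        \<le> rpow (cmod (of_real \<delta> - 1 - z0 * deriv (deriv f) z0 / deriv f z0
        + unit_quot (\<lambda>z. z * deriv g z) g z0)) \<gamma>"
      using assms(8,10,12) \<rho> by (intro rpow_mono) auto
    \<comment> \<open>At \<open>z0\<close> the first factor of the hypothesis equals
      \<open>rpow \<rho> \<beta>\<close>, so the bound on the second factor alone contradicts the
      strict inequality.\<close>
    then have "rpow \<rho> \<beta> * rpow (\<delta> + \<mu> * \<rho> * real n / (1 + \<rho>)) \<gamma>
        \<le> rpow (cmod (w z0)) \<beta> * rpow (cmod (of_real \<delta> - 1 - z0 * deriv (deriv f) z0 / deriv f z0
        + unit_quot (\<lambda>z. z * deriv g z) g z0)) \<gamma>"
      unfolding z0(3) by (rule mult_left_mono) (rule rpow_nonneg)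
    then show False
      using assms(14) z0(1) unfolding w_def p_def q_def by force
  qed

  \<comment> \<open>Strong close-to-convexity\<close>
  moreover have "f \<in> STC \<mu>" if "\<rho> < 1"
  proof -
    define r where "r = unit_quot (\<lambda>z. z * deriv f z) g"
    have rq: "r z = 1 / q z" for z by (simp add: r_def q_def unit_quot_def)
    have r: "r holomorphic_on \<U>" "\<And>z. z \<in> \<U> \<Longrightarrow> r z \<noteq> 0" "r 0 = 1"
      unfolding rq using q qnz q0 by (auto intro!: holomorphic_intros)
    \<comment> \<open>\<open>r\<close> is the reciprocal of \<open>q\<close>, at 0 too, where both
      are 1. By uniqueness of the branch its logarithm is \<open>- L\<close>, so its power is the
      reciprocal of \<open>p\<close>.\<close>
    have log: "disk_log r z = - L z" if "z \<in> \<U>" for z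
    proof (rule disk_log_unique[where h = r and M = "\<lambda>u. - L u"])
      show "exp (- L u) = r u" if "u \<in> \<U>" for u
        by (simp add: rq exp_minus inverse_eq_divide L(3)[OF that])
    qed (use disk_log[where h = r, OF r] L that in \<open>auto intro!: holomorphic_intros\<close>)
    have "Re (disk_power r (1 / \<mu>) z) > 0" if "z \<in> \<U>" for z
    proof -
      have "disk_power r (1 / \<mu>) z = inverse (p z)"
        by (simp add: disk_power_def p_def' log[OF that] exp_minus)
      \<comment> \<open>\<open>p z\<close> lies within distance \<open>\<rho> < 1\<close> of 1;
        taking reciprocals preserves the right half-plane.\<close>
      moreover have "Re (p z) > 0"
        using main[OF that] \<open>\<rho> < 1\<close> abs_Re_le_cmod[of "w z"] by (simp add: w_def)
      ultimately show ?thesis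
        by (simp add: zero_less_divide_iff add_pos_nonneg)
    qed
    moreover have "f \<in> class_A 1" using class_A_mono[OF assms(4)] assms(1) by simp
    ultimately show ?thesis
      using assms(5,6) unfolding STC_def r_def by blast
  qed
  ultimately show ?thesis by (auto simp: w_def p_def q_def)
qed

end
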